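(* Fix $d\in\mathbb{N}$, $d\geq 1$, and let $\xi>d$ be a real number. There exists a sequence $(\mu_k)$ of centered probability measures on $\mathbb{R}^d$ with finite second moments such that: (i) $\lim_{k\to\infty}\mathrm{Tr}(\mathrm{Cov}(\mu_k))=\xi$; (ii) $\lim_{k\to\infty}\delta_{\mathrm{Tal}}(\mu_k)=0$; (iii) $\liminf_{k\to\infty}\mathcal{W}_2^2(\mu_k,\gamma)\geq\xi-d>0$.
   Context: $\gamma$ is the standard Gaussian measure on $\mathbb{R}^d$. The relative entropy of probability measures is $\mathrm{D}(\mu||\nu)=\int\ln\left(\frac{d\mu}{d\nu}\right)d\mu$, with value $+\infty$ if $\mu$ is not absolutely continuous with respect to $\nu$. The quadratic Wasserstein distance is $\mathcal{W}_2(\mu,\gamma)=\left(\inf_\pi\int_{\mathbb{R}^{2d}}\|x-y\|_2^2\,d\pi(x,y)\right)^{1/2}$, the infimum being over couplings $\pi$ of $\mu$ and $\gamma$. The deficit in Talagrand's inequality is $\delta_{\mathrm{Tal}}(\mu)=2\mathrm{D}(\mu||\gamma)-\mathcal{W}_2^2(\mu,\gamma)$ (equal to $+\infty$ if $\mathrm{D}(\mu||\gamma)=\infty$). $\mathrm{Cov}(\mu)$ is the covariance matrix of $\mu$. Centered means $\int x\,d\mu(x)=0$. *)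

theory Defs
  imports "HOL-Probability.Probability"
begin

definition std_gaussian :: "(real ^ 'n) measure" where
  "std_gaussian = density lborel (\<lambda>x. ennreal (\<Prod>i\<in>UNIV. std_normal_density (x $ i)))"

text \<open>
  \<open>KL_divergence\<close> is a Bochner integral, hence \<open>0\<close> when the integrand is not integrable. For
  probability measures \<open>\<mu> \<lless> \<nu>\<close> the negative part of \<open>ln (d\<mu>/d\<nu>)\<close> is always \<open>\<mu>\<close>-integrable, so
  non-integrability means that the integral is \<open>+\<infinity>\<close>. The base \<open>exp 1\<close> gives the natural
  logarithm; the library lists the reference measure \<open>\<nu>\<close> first.
\<close>
definition rel_entropy :: "'a measure \<Rightarrow> 'a measure \<Rightarrow> ereal" where
  "rel_entropy \<mu> \<nu> =
     (if absolutely_continuous \<nu> \<mu> \<and> integrable \<mu> (entropy_density (exp 1) \<nu> \<mu>)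
      then ereal (KL_divergence (exp 1) \<nu> \<mu>) else \<infinity>)"

definition couplings :: "'a measure \<Rightarrow> 'b measure \<Rightarrow> ('a \<times> 'b) measure set" where
  "couplings \<mu> \<nu> =
     {\<pi>. sets \<pi> = sets (\<mu> \<Otimes>\<^sub>M \<nu>) \<and> distr \<pi> \<mu> fst = \<mu> \<and> distr \<pi> \<nu> snd = \<nu>}"

definition transport_cost :: "'a::real_normed_vector measure \<Rightarrow> 'a measure \<Rightarrow> ennreal" where
  "transport_cost \<mu> \<nu> =
     (INF \<pi>\<in>couplings \<mu> \<nu>. \<integral>\<^sup>+ (x, y). ennreal ((norm (x - y))\<^sup>2) \<partial>\<pi>)"

text \<open>There is no square root on \<open>ennreal\<close>, hence the case distinction.\<close>
definition wasserstein2 :: "'a::real_normed_vector measure \<Rightarrow> 'a measure \<Rightarrow> ennreal" where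
  "wasserstein2 \<mu> \<nu> =
     (if transport_cost \<mu> \<nu> = \<infinity> then \<infinity>
      else ennreal (sqrt (enn2real (transport_cost \<mu> \<nu>))))"

definition talagrand_deficit :: "(real ^ 'n) measure \<Rightarrow> ereal" where
  "talagrand_deficit \<mu> =
     (if rel_entropy \<mu> std_gaussian = \<infinity> then \<infinity>
      else 2 * rel_entropy \<mu> std_gaussian - enn2ereal ((wasserstein2 \<mu> std_gaussian)\<^sup>2))"

definition finite_second_moment :: "'a::real_normed_vector measure \<Rightarrow> bool" where
  "finite_second_moment \<mu> \<longleftrightarrow> integrable \<mu> (\<lambda>x. (norm x)\<^sup>2)"

definition mean :: "(real ^ 'n) measure \<Rightarrow> real ^ 'n" where
  "mean \<mu> = (\<integral>x. x \<partial>\<mu>)"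

definition centered :: "(real ^ 'n) measure \<Rightarrow> bool" where
  "centered \<mu> \<longleftrightarrow> integrable \<mu> (\<lambda>x. x) \<and> mean \<mu> = 0"

definition Cov :: "(real ^ 'n) measure \<Rightarrow> real ^ 'n ^ 'n" where
  "Cov \<mu> = (\<chi> i j. \<integral>x. (x $ i - mean \<mu> $ i) * (x $ j - mean \<mu> $ j) \<partial>\<mu>)"

end

theory Submission
  imports Defs "HOL-Real_Asymp.Real_Asymp"
begin

text \<open>
  Take \<open>\<mu>\<close> to be the law of \<open>X + T e\<^sub>i\<close> with \<open>X \<sim> \<gamma>\<close> and an independent \<open>T\<close> equal to \<open>\<plusminus>a\<close> with
  probability \<open>\<epsilon>/2\<close> each and to \<open>0\<close> otherwise, where \<open>\<epsilon> a\<^sup>2 = s = \<xi> - d\<close>. For any finite mixture of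
  shifted Gaussians with weights \<open>p\<^sub>k\<close> and shifts \<open>t\<^sub>k\<close>, the density \<open>f = \<Sum> p\<^sub>k g\<^sub>k\<close> satisfies
  \<open>f \<ge> p\<^sub>k g\<^sub>k\<close>, and \<open>u ln u\<close> is convex; hence
  \<open>2 \<Sum> p\<^sub>k ln p\<^sub>k + \<Sum> p\<^sub>k t\<^sub>k\<^sup>2 \<le> 2 D(\<mu>||\<gamma>) \<le> \<Sum> p\<^sub>k t\<^sub>k\<^sup>2\<close>. The coupling \<open>(X + T e\<^sub>i, X)\<close> gives
  \<open>W\<^sub>2\<^sup>2 \<le> \<Sum> p\<^sub>k t\<^sub>k\<^sup>2\<close>, and Kantorovich duality with the potential
  \<open>max 0 ((1 - \<delta>) x\<^sub>i\<^sup>2 - K)\<close> gives a matching lower bound. As \<open>\<epsilon> \<rightarrow> 0\<close>, both \<open>2 D\<close> and \<open>W\<^sub>2\<^sup>2\<close> tend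
  to \<open>s\<close>, so Talagrand's inequality itself is not needed.
\<close>

section \<open>Marginals and moments of the standard Gaussian measure\<close>

text \<open>This is \<open>nn_integral_lborel_prod\<close> with the product over
  \<open>Basis\<close> reindexed by coordinates through \<open>axis j 1\<close>.\<close>

lemma nn_integral_lborel_prod_vec:
  fixes f :: "'n::finite \<Rightarrow> real \<Rightarrow> ennreal"
  assumes [measurable]: "\<And>j. f j \<in> borel_measurable borel"
  shows "(\<integral>\<^sup>+x. (\<Prod>j\<in>UNIV. f j (x $ j)) \<partial>(lborel :: (real ^ 'n) measure)) =
    (\<Prod>j\<in>UNIV. \<integral>\<^sup>+y. f j y \<partial>lborel)"
proof -
  define e :: "'n \<Rightarrow> real ^ 'n" where "e j = axis j 1" for j
  have inj: "inj e"
    by (auto simp: inj_def e_def axis_eq_axis)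
  have Basis: "Basis = range e"
    by (auto simp: e_def Basis_vec_def)
  have reindex: "(\<Prod>b\<in>Basis. G (inv e b) b) = (\<Prod>j\<in>UNIV. G j (e j))"
    for G :: "'n \<Rightarrow> real ^ 'n \<Rightarrow> ennreal"
    unfolding Basis using inj by (simp add: prod.reindex inv_f_f)
  have "(\<integral>\<^sup>+x. (\<Prod>j\<in>UNIV. f j (x $ j)) \<partial>(lborel :: (real ^ 'n) measure)) =
      (\<integral>\<^sup>+x. (\<Prod>b\<in>Basis. f (inv e b) (x \<bullet> b)) \<partial>lborel)"
    unfolding reindex[of "\<lambda>j b. f j (_ \<bullet> b)"] by (simp add: e_def inner_axis)
  also have "\<dots> = (\<Prod>b\<in>Basis. \<integral>\<^sup>+y. f (inv e b) y \<partial>lborel)"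
    by (rule nn_integral_lborel_prod) auto
  also have "\<dots> = (\<Prod>j\<in>UNIV. \<integral>\<^sup>+y. f j y \<partial>lborel)"
    by (rule reindex)
  finally show ?thesis .
qed

lemma sets_std_gaussian [simp, measurable_cong]: "sets std_gaussian = sets borel"
  by (simp add: std_gaussian_def)

lemma space_std_gaussian [simp]: "space std_gaussian = UNIV"
  by (simp add: std_gaussian_def)

lemma nn_integral_std_normal_density: "(\<integral>\<^sup>+y. ennreal (std_normal_density y) \<partial>lborel) = 1"
  by (subst nn_integral_eq_integral) auto

text \<open>The indicator is absorbed into factor \<open>i\<close> of the product density, and every
  other factor integrates to 1. All later Gaussian integrals thereby become one-dimensional
  moments.\<close>

lemma distr_std_gaussian_nth:
  "distr std_gaussian borel (\<lambda>x :: real ^ 'n::finite. x $ i) = density lborel std_normal_density"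
proof (rule measure_eqI)
  fix A assume "A \<in> sets (distr std_gaussian borel (\<lambda>x :: real ^ 'n. x $ i))"
  then have A [measurable]: "A \<in> sets borel"
    by simp
  have "emeasure (distr std_gaussian borel (\<lambda>x :: real ^ 'n. x $ i)) A =
      (\<integral>\<^sup>+x. indicator A (x $ i) \<partial>(std_gaussian :: (real ^ 'n) measure))"
    by (simp flip: nn_integral_indicator add: nn_integral_distr)
  also have "\<dots> = (\<integral>\<^sup>+x. ennreal (\<Prod>j\<in>UNIV. std_normal_density (x $ j)) * indicator A (x $ i)
      \<partial>(lborel :: (real ^ 'n) measure))"
    unfolding std_gaussian_def by (rule nn_integral_density) measurable
  also have "\<dots> = (\<integral>\<^sup>+x. (\<Prod>j\<in>UNIV. ennreal (std_normal_density (x $ j)) *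
      (if j = i then indicator A (x $ j) else 1)) \<partial>(lborel :: (real ^ 'n) measure))"
    by (simp add: prod.distrib prod_ennreal cong: if_cong)
  also have "\<dots> = (\<Prod>j\<in>UNIV. \<integral>\<^sup>+y. ennreal (std_normal_density y) *
      (if j = i then indicator A y else 1) \<partial>lborel)"
    by (rule nn_integral_lborel_prod_vec) measurable
  also have "\<dots> = (\<Prod>j\<in>UNIV.
      if j = i then emeasure (density lborel std_normal_density) A else 1)"
    by (intro prod.cong) (auto simp: emeasure_density nn_integral_std_normal_density)
  finally show "emeasure (distr std_gaussian borel (\<lambda>x :: real ^ 'n. x $ i)) A =
      emeasure (density lborel std_normal_density) A"
    by simp
qed simp

lemma prob_space_std_gaussian: "prob_space (std_gaussian :: (real ^ 'n::finite) measure)"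
proof -
  \<comment> \<open>The total mass can be read off any one-dimensional marginal;
    \<open>undefined\<close> is just some coordinate.\<close>
  have "emeasure (std_gaussian :: (real ^ 'n) measure) UNIV =
      emeasure (distr std_gaussian borel (\<lambda>x :: real ^ 'n. x $ undefined)) UNIV"
    by (subst emeasure_distr) auto
  also have "\<dots> = 1"
    unfolding distr_std_gaussian_nth
    using prob_space.emeasure_space_1[OF prob_space_normal_density[of 1 0]] by simp
  finally show ?thesis
    by (intro prob_spaceI) simp
qed

interpretation std_gaussian: prob_space std_gaussian
  by (rule prob_space_std_gaussian)

lemma has_bochner_integral_std_gaussian_nth:
  fixes h :: "real \<Rightarrow> real" and i :: "'n::finite"
  assumes [measurable]: "h \<in> borel_measurable borel"
    and "has_bochner_integral lborel (\<lambda>y. std_normal_density y * h y) c"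
  shows "has_bochner_integral std_gaussian (\<lambda>x :: real ^ 'n. h (x $ i)) c"
proof -
  have "has_bochner_integral (distr std_gaussian borel (\<lambda>x :: real ^ 'n. x $ i)) h c"
    unfolding distr_std_gaussian_nth
    using assms by (intro has_bochner_integral_density) auto
  then show ?thesis
    by (auto simp: has_bochner_integral_iff integrable_distr_eq integral_distr)
qed

lemma std_gaussian_nth_moments:
  fixes i :: "'n::finite"
  shows "has_bochner_integral std_gaussian (\<lambda>x :: real ^ 'n. x $ i) 0"
    and "has_bochner_integral std_gaussian (\<lambda>x :: real ^ 'n. (x $ i)\<^sup>2) 1"
    and "has_bochner_integral std_gaussian (\<lambda>x :: real ^ 'n. (x $ i) ^ 4) 3"
  using has_bochner_integral_std_gaussian_nth[OF _ std_normal_moment_odd[of 0], of i]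
    has_bochner_integral_std_gaussian_nth[OF _ std_normal_moment_even[of 1], of i]
    has_bochner_integral_std_gaussian_nth[OF _ std_normal_moment_even[of 2], of i]
  by (simp_all add: fact_numeral)

lemma std_gaussian_nth_integrals [simp]:
  fixes i :: "'n::finite"
  shows "integrable std_gaussian (\<lambda>x :: real ^ 'n. x $ i)"
    "integrable std_gaussian (\<lambda>x :: real ^ 'n. (x $ i)\<^sup>2)"
    "integrable std_gaussian (\<lambda>x :: real ^ 'n. (x $ i) ^ 4)"
    "(\<integral>x. x $ i \<partial>(std_gaussian :: (real ^ 'n) measure)) = 0"
    "(\<integral>x. (x $ i)\<^sup>2 \<partial>(std_gaussian :: (real ^ 'n) measure)) = 1"
    "(\<integral>x. (x $ i) ^ 4 \<partial>(std_gaussian :: (real ^ 'n) measure)) = 3"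
  using std_gaussian_nth_moments[of i] by (auto simp: has_bochner_integral_iff)

section \<open>Shifted Gaussians as densities\<close>

text \<open>The Radon-Nikodym density of \<open>N(t, 1)\<close> with respect to \<open>N(0, 1)\<close>.\<close>

definition shift_density :: "real \<Rightarrow> real \<Rightarrow> real" where
  "shift_density t y = exp (t * y - t\<^sup>2 / 2)"

lemma shift_density_measurable [measurable]: "shift_density t \<in> borel_measurable borel"
  unfolding shift_density_def by measurable

lemma shift_density_pos: "shift_density t y > 0"
  by (simp add: shift_density_def)

text \<open>The Cameron-Martin formula in a coordinate direction. Translation invariance of
  \<open>lborel\<close> moves the shift onto the Gaussian weight, where only factor \<open>i\<close>
  changes, by exactly \<open>shift_density t (x $ i)\<close>.\<close>

lemma distr_std_gaussian_shift:
  fixes i :: "'n::finite"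
  shows "distr std_gaussian borel (\<lambda>x. x + axis i t) =
    density std_gaussian (\<lambda>x. ennreal (shift_density t (x $ i)))"
proof -
  define G where "G x = (\<Prod>j\<in>UNIV. std_normal_density (x $ j))" for x :: "real ^ 'n"
  have [measurable]: "G \<in> borel_measurable borel"
    unfolding G_def by measurable
  have G: "G (x - axis i t) = G x * shift_density t (x $ i)" for x
  proof -
    have "G (x - axis i t) = (\<Prod>j\<in>UNIV. std_normal_density (x $ j) *
        (if j = i then shift_density t (x $ j) else 1))"
      unfolding G_def
      by (intro prod.cong) (auto simp: axis_def std_normal_density_def shift_density_def
          power2_diff field_simps simp flip: exp_add)
    also have "\<dots> = G x * shift_density t (x $ i)"
      by (simp add: prod.distrib G_def cong: if_cong)
    finally show ?thesis .
  qed
  show ?thesis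
  proof (rule measure_eqI)
    fix A assume "A \<in> sets (distr std_gaussian borel (\<lambda>x :: real ^ 'n. x + axis i t))"
    then have A [measurable]: "A \<in> sets borel"
      by simp
    have "emeasure (distr std_gaussian borel (\<lambda>x :: real ^ 'n. x + axis i t)) A =
        (\<integral>\<^sup>+x. indicator A (x + axis i t) \<partial>(std_gaussian :: (real ^ 'n) measure))"
      by (simp flip: nn_integral_indicator add: nn_integral_distr)
    also have "\<dots> = (\<integral>\<^sup>+x. ennreal (G x) * indicator A (x + axis i t) \<partial>lborel)"
      unfolding std_gaussian_def G_def by (rule nn_integral_density) measurable
    also have "\<dots> = (\<integral>\<^sup>+x. ennreal (G (x - axis i t)) * indicator A x
        \<partial>distr lborel borel ((+) (axis i t)))"
      by (subst nn_integral_distr) (auto simp: add.commute)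
    also have "\<dots> = (\<integral>\<^sup>+x. ennreal (G x) *
        (ennreal (shift_density t (x $ i)) * indicator A x) \<partial>lborel)"
      unfolding lborel_distr_plus G
      by (intro nn_integral_cong)
        (auto simp: ennreal_mult'' shift_density_pos less_imp_le mult_ac)
    also have "\<dots> = (\<integral>\<^sup>+x. ennreal (shift_density t (x $ i)) * indicator A x \<partial>std_gaussian)"
      unfolding std_gaussian_def G_def by (rule nn_integral_density[symmetric]) measurable
    also have "\<dots> = emeasure (density std_gaussian (\<lambda>x. ennreal (shift_density t (x $ i)))) A"
      by (rule emeasure_density[symmetric]) measurable
    finally show "emeasure (distr std_gaussian borel (\<lambda>x :: real ^ 'n. x + axis i t)) A =
        emeasure (density std_gaussian (\<lambda>x. ennreal (shift_density t (x $ i)))) A" .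
  qed simp
qed

text \<open>Both sides integrate \<open>h\<close> against the same measure, once as a density and
  once as the law of a translate.\<close>

lemma integral_shift_density:
  fixes h :: "real ^ 'n::finite \<Rightarrow> real"
  assumes [measurable]: "h \<in> borel_measurable borel"
  shows "integrable std_gaussian (\<lambda>x. shift_density t (x $ i) * h x) \<longleftrightarrow>
      integrable std_gaussian (\<lambda>x. h (x + axis i t))"
    and "(\<integral>x. shift_density t (x $ i) * h x \<partial>std_gaussian) =
      (\<integral>x. h (x + axis i t) \<partial>std_gaussian)"
proof -
  have "integrable std_gaussian (\<lambda>x. shift_density t (x $ i) * h x) \<longleftrightarrow>
      integrable (density std_gaussian (\<lambda>x. ennreal (shift_density t (x $ i)))) h"
    by (subst integrable_density) (auto simp: shift_density_pos less_imp_le)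
  then show "integrable std_gaussian (\<lambda>x. shift_density t (x $ i) * h x) \<longleftrightarrow>
      integrable std_gaussian (\<lambda>x. h (x + axis i t))"
    unfolding distr_std_gaussian_shift[symmetric] by (simp add: integrable_distr_eq)
  have "(\<integral>x. shift_density t (x $ i) * h x \<partial>std_gaussian) =
      (\<integral>x. h x \<partial>density std_gaussian (\<lambda>x. ennreal (shift_density t (x $ i))))"
    by (subst integral_density) (auto simp: shift_density_pos less_imp_le)
  then show "(\<integral>x. shift_density t (x $ i) * h x \<partial>std_gaussian) =
      (\<integral>x. h (x + axis i t) \<partial>std_gaussian)"
    unfolding distr_std_gaussian_shift[symmetric] by (simp add: integral_distr)
qed

section \<open>Finite mixtures of shifted Gaussians and their moments\<close>

text \<open>Positive weights make the logarithms of weights and of the mixture density genuine; the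
  zero mean shift yields centered mixtures.\<close>

locale gaussian_mixture =
  fixes q :: "'k::finite pmf" and t :: "'k \<Rightarrow> real" and i :: "'n::finite"
  assumes pmf_pos: "\<And>k. pmf q k > 0"
    and mean_zero: "(\<Sum>k\<in>UNIV. pmf q k * t k) = 0"
begin

definition shift_variance :: real where
  "shift_variance = (\<Sum>k\<in>UNIV. pmf q k * (t k)\<^sup>2)"

definition mix_density :: "real \<Rightarrow> real" where
  "mix_density y = (\<Sum>k\<in>UNIV. pmf q k * shift_density (t k) y)"

definition mixture :: "(real ^ 'n) measure" where
  "mixture = density std_gaussian (\<lambda>x. ennreal (mix_density (x $ i)))"

lemma mix_density_measurable [measurable]: "mix_density \<in> borel_measurable borel"
  unfolding mix_density_def by measurable

lemma sum_pmf [simp]: "(\<Sum>k\<in>UNIV. pmf q k) = 1"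
  by (rule sum_pmf_eq_1) auto

lemma mix_density_ge: "pmf q k * shift_density (t k) y \<le> mix_density y"
  unfolding mix_density_def
  by (rule member_le_sum) (auto simp: shift_density_pos less_imp_le)

lemma mix_density_pos: "mix_density y > 0"
  using mix_density_ge[of undefined y] mult_pos_pos[OF pmf_pos shift_density_pos]
  by (rule less_le_trans[rotated])

lemma sets_mixture [simp, measurable_cong]: "sets mixture = sets borel"
  by (simp add: mixture_def)

lemma space_mixture [simp]: "space mixture = UNIV"
  by (simp add: mixture_def)

text \<open>The mixture density is a finite sum, so integration splits over the components, and each
  of these is a translate of the Gaussian. Integrability has to be checked only per
  component.\<close>

lemma has_bochner_integral_mixture:
  fixes h :: "real ^ 'n \<Rightarrow> real"
  assumes [measurable]: "h \<in> borel_measurable borel"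
    and int: "\<And>k. integrable std_gaussian (\<lambda>x. h (x + axis i (t k)))"
  shows "has_bochner_integral mixture h
    (\<Sum>k\<in>UNIV. pmf q k * (\<integral>x. h (x + axis i (t k)) \<partial>std_gaussian))"
proof -
  have "has_bochner_integral std_gaussian
      (\<lambda>x. \<Sum>k\<in>UNIV. pmf q k * (shift_density (t k) (x $ i) * h x))
      (\<Sum>k\<in>UNIV. pmf q k * (\<integral>x. h (x + axis i (t k)) \<partial>std_gaussian))"
    using int
    by (intro has_bochner_integral_sum has_bochner_integral_mult_right)
      (auto simp: has_bochner_integral_iff integral_shift_density)
  then show ?thesis
    unfolding mixture_def
    by (intro has_bochner_integral_density)
      (auto simp: mix_density_pos less_imp_le sum_distrib_right mult.assoc mix_density_def
        intro!: AE_I2 sum_nonneg mult_nonneg_nonneg shift_density_pos[THEN less_imp_le])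
qed

lemmas integrable_mixture = has_bochner_integral_mixture[THEN integrable.intros]
lemmas integral_mixture = has_bochner_integral_mixture[THEN has_bochner_integral_integral_eq]

lemma prob_space_mixture: "prob_space mixture"
proof
  have "emeasure mixture (space mixture) = ennreal (\<integral>x. 1 \<partial>mixture)"
    using integrable_mixture[of "\<lambda>_. 1"]
    by (subst nn_integral_eq_integral[symmetric]) auto
  also have "(\<integral>x. 1 \<partial>mixture) = (1 :: real)"
    by (subst integral_mixture) (auto simp: std_gaussian.prob_space[simplified])
  finally show "emeasure mixture (space mixture) = 1"
    by simp
qed

lemma mixture_nth_moments:
  shows "has_bochner_integral mixture (\<lambda>x. x $ j) 0"
    and "has_bochner_integral mixture (\<lambda>x. (x $ j)\<^sup>2) (1 + (if j = i then shift_variance else 0))"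
proof -
  have "has_bochner_integral mixture (\<lambda>x. x $ j)
      (\<Sum>k\<in>UNIV. pmf q k * (\<integral>x. (x + axis i (t k)) $ j \<partial>std_gaussian))"
    by (rule has_bochner_integral_mixture) auto
  then show "has_bochner_integral mixture (\<lambda>x. x $ j) 0"
    using mean_zero
    by (cases "j = i") (simp_all add: axis_def std_gaussian.prob_space[simplified])
  \<comment> \<open>The three summands are the Gaussian second moment, the cross term with the
    vanishing first moment, and the squared shift times the total mass.\<close>
  have sq: "has_bochner_integral std_gaussian (\<lambda>x :: real ^ 'n. ((x + axis i (t k)) $ j)\<^sup>2)
      (1 + 2 * axis i (t k) $ j * 0 + (axis i (t k) $ j)\<^sup>2 * 1)" for k
    unfolding vector_add_component power2_sum mult.commute[of "2 * _"]
    by (auto simp: has_bochner_integral_iff std_gaussian.prob_space[simplified] axis_def)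
  have "has_bochner_integral mixture (\<lambda>x. (x $ j)\<^sup>2)
      (\<Sum>k\<in>UNIV. pmf q k * (\<integral>x. ((x + axis i (t k)) $ j)\<^sup>2 \<partial>std_gaussian))"
    using sq by (intro has_bochner_integral_mixture) (auto simp: has_bochner_integral_iff)
  also have "(\<Sum>k\<in>UNIV. pmf q k * (\<integral>x. ((x + axis i (t k)) $ j)\<^sup>2 \<partial>std_gaussian)) =
      (\<Sum>k\<in>UNIV. pmf q k * (1 + (axis i (t k) $ j)\<^sup>2))"
    using sq by (simp add: has_bochner_integral_iff)
  also have "\<dots> = 1 + (if j = i then shift_variance else 0)"
    by (auto simp: axis_def shift_variance_def distrib_left sum.distrib)
  finally show "has_bochner_integral mixture (\<lambda>x. (x $ j)\<^sup>2)
      (1 + (if j = i then shift_variance else 0))" .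
qed

lemma finite_second_moment_mixture: "finite_second_moment mixture"
  unfolding finite_second_moment_def norm_vec_def L2_set_def
  using mixture_nth_moments(2) by (auto simp: has_bochner_integral_iff sum_nonneg)

lemma integrable_mixture_id: "integrable mixture (\<lambda>x. x)"
proof (rule Bochner_Integration.integrable_bound)
  interpret prob_space mixture
    by (rule prob_space_mixture)
  show "integrable mixture (\<lambda>x. 1 + (norm x)\<^sup>2)"
    using finite_second_moment_mixture by (auto simp: finite_second_moment_def)
  have "y \<le> 1 + y\<^sup>2" if "y \<ge> 0" for y :: real
    using zero_le_power2[of "y - 1"] that by (simp add: power2_diff)
  then show "AE x in mixture. norm x \<le> norm (1 + (norm x)\<^sup>2)"
    by simp
qed simp

lemma mean_mixture: "mean mixture = 0"
proof (rule vec_eq_iff[THEN iffD2], rule allI)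
  fix j
  have "mean mixture $ j = (\<integral>x. x $ j \<partial>mixture)"
    unfolding mean_def
    by (rule integral_bounded_linear[OF bounded_linear_vec_nth integrable_mixture_id, symmetric])
  also have "\<dots> = 0"
    using mixture_nth_moments(1) by (simp add: has_bochner_integral_iff)
  finally show "mean mixture $ j = 0 $ j"
    by simp
qed

lemma centered_mixture: "centered mixture"
  using integrable_mixture_id mean_mixture by (simp add: centered_def)

lemma trace_Cov_mixture: "trace (Cov mixture) = real CARD('n) + shift_variance"
proof -
  have "trace (Cov mixture) = (\<Sum>j\<in>UNIV. 1 + (if j = i then shift_variance else 0))"
    using mixture_nth_moments(2)
    by (simp add: trace_def Cov_def mean_mixture has_bochner_integral_iff flip: power2_eq_square)
  then show ?thesis
    by (simp add: sum.distrib)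
qed

section \<open>Relative entropy of the mixture\<close>

text \<open>All components but one are dropped from the mixture density; the price is
  \<open>ln (pmf q k)\<close>.\<close>

lemma ln_mix_density_ge: "ln (pmf q k) + t k * y - (t k)\<^sup>2 / 2 \<le> ln (mix_density y)"
proof -
  have "ln (pmf q k * shift_density (t k) y) \<le> ln (mix_density y)"
    using mix_density_ge[of k y] pmf_pos[of k] shift_density_pos[of "t k" y] mix_density_pos[of y]
    by simp
  then show ?thesis
    using pmf_pos[of k] by (simp add: ln_mult shift_density_def)
qed

text \<open>Linear growth with constants independent of \<open>y\<close>, which makes the logarithm
  integrable under every translate of the Gaussian. The upper bound comes from the largest possible
  exponent, the lower one from an arbitrary single component.\<close>

lemma ln_mix_density_bound:
  obtains C M where "\<And>y. \<bar>ln (mix_density y)\<bar> \<le> C + M * \<bar>y\<bar>"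
proof
  fix y
  define M where "M = (\<Sum>k\<in>UNIV. \<bar>t k\<bar>)"
  let ?k = "undefined :: 'k"
  have M: "\<bar>t k\<bar> \<le> M" for k
    unfolding M_def by (rule member_le_sum) auto
  have tM: "\<bar>t k * y\<bar> \<le> M * \<bar>y\<bar>" for k
    using M[of k] by (simp add: abs_mult mult_right_mono)
  have "mix_density y \<le> (\<Sum>k\<in>UNIV. pmf q k * exp (M * \<bar>y\<bar>))"
    unfolding mix_density_def shift_density_def
  proof (intro sum_mono mult_left_mono)
    fix k
    have "t k * y - (t k)\<^sup>2 / 2 \<le> \<bar>t k * y\<bar>"
      using zero_le_power2[of "t k"] by linarith
    then show "exp (t k * y - (t k)\<^sup>2 / 2) \<le> exp (M * \<bar>y\<bar>)"
      using tM[of k] by simp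
  qed simp
  also have "\<dots> = exp (M * \<bar>y\<bar>)"
    by (simp flip: sum_distrib_right)
  finally have "ln (mix_density y) \<le> M * \<bar>y\<bar>"
    using mix_density_pos[of y] by (simp add: ln_le_cancel_iff[symmetric] del: ln_le_cancel_iff)
  then show "\<bar>ln (mix_density y)\<bar> \<le> (\<bar>ln (pmf q ?k)\<bar> + (t ?k)\<^sup>2 / 2) + M * \<bar>y\<bar>"
    using ln_mix_density_ge[of ?k y] tM[of ?k] zero_le_power2[of "t ?k"] by linarith
qed

lemma integrable_ln_mix_density:
  "integrable std_gaussian (\<lambda>x :: real ^ 'n. ln (mix_density (x $ i + c)))"
proof -
  obtain C M where CM: "\<And>y. \<bar>ln (mix_density y)\<bar> \<le> C + M * \<bar>y\<bar>"
    using ln_mix_density_bound by blast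
  show ?thesis
  proof (rule Bochner_Integration.integrable_bound)
    show "integrable std_gaussian (\<lambda>x :: real ^ 'n. C + M * \<bar>x $ i + c\<bar>)"
      by simp
  qed (use CM in \<open>auto intro!: AE_I2 intro: order_trans[OF _ abs_ge_self]\<close>)
qed

lemma integrable_mixture_ln_mix_density: "integrable mixture (\<lambda>x. ln (mix_density (x $ i)))"
  using integrable_ln_mix_density by (intro integrable_mixture) auto

text \<open>The Radon-Nikodym derivative is determined only almost everywhere. Equality holds first
  for \<open>std_gaussian\<close> and passes to \<open>mixture\<close> by absolute
  continuity.\<close>

lemma AE_entropy_density_mixture:
  "AE x in mixture. entropy_density (exp 1) std_gaussian mixture x = ln (mix_density (x $ i))"
proof -
  have "AE x in std_gaussian.
      ennreal (mix_density (x $ i)) = RN_deriv std_gaussian mixture x"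
    by (rule std_gaussian.RN_deriv_unique) (auto simp: mixture_def)
  then have "AE x in std_gaussian.
      entropy_density (exp 1) std_gaussian mixture x = ln (mix_density (x $ i))"
  proof eventually_elim
    case (elim x)
    show ?case
      by (simp add: entropy_density_def flip: elim)
        (simp add: mix_density_pos less_imp_le log_def)
  qed
  then show ?thesis
    unfolding mixture_def by (subst AE_density) auto
qed

text \<open>Integrability of the log density selects the finite branch of
  \<open>rel_entropy\<close>.\<close>

lemma rel_entropy_mixture:
  "rel_entropy mixture std_gaussian = ereal (\<integral>x. ln (mix_density (x $ i)) \<partial>mixture)"
proof -
  have [measurable]: "entropy_density (exp 1) std_gaussian mixture \<in> borel_measurable mixture"
    using measurable_entropy_density[of "exp 1" std_gaussian mixture]
    by (simp cong: measurable_cong_sets)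
  have "absolutely_continuous std_gaussian mixture"
    unfolding mixture_def by (rule absolutely_continuousI_density) measurable
  moreover have "integrable mixture (entropy_density (exp 1) std_gaussian mixture)"
    using integrable_mixture_ln_mix_density AE_entropy_density_mixture
    by (subst integrable_cong_AE[where g = "\<lambda>x. ln (mix_density (x $ i))"]) auto
  moreover have "KL_divergence (exp 1) std_gaussian mixture =
      (\<integral>x. ln (mix_density (x $ i)) \<partial>mixture)"
    unfolding KL_divergence_def
    using AE_entropy_density_mixture by (intro integral_cong_AE) auto
  ultimately show ?thesis
    by (simp add: rel_entropy_def)
qed

text \<open>Under component \<open>k\<close> the coordinate has mean \<open>t k\<close>, so
  integrating \<open>ln_mix_density_ge\<close> leaves
  \<open>ln (pmf q k) + (t k)\<^sup>2 / 2\<close>. The gap to the upper bound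
  \<open>shift_variance / 2\<close> is the Shannon entropy of the weights.\<close>

lemma entropy_mixture_ge:
  "(\<Sum>k\<in>UNIV. pmf q k * ln (pmf q k)) + shift_variance / 2 \<le> (\<integral>x. ln (mix_density (x $ i)) \<partial>mixture)"
proof -
  have "(\<Sum>k\<in>UNIV. pmf q k * (ln (pmf q k) + (t k)\<^sup>2 / 2)) \<le>
      (\<Sum>k\<in>UNIV. pmf q k * (\<integral>x. ln (mix_density ((x + axis i (t k)) $ i)) \<partial>std_gaussian))"
  proof (intro sum_mono mult_left_mono)
    fix k
    have "ln (pmf q k) + (t k)\<^sup>2 / 2 =
        (\<integral>x. ln (pmf q k) + t k * (x $ i + t k) - (t k)\<^sup>2 / 2
          \<partial>(std_gaussian :: (real ^ 'n) measure))"
      by (simp add: std_gaussian.prob_space[simplified] distrib_left power2_eq_square)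
    also have "\<dots> \<le> (\<integral>x. ln (mix_density ((x + axis i (t k)) $ i)) \<partial>std_gaussian)"
      using integrable_ln_mix_density ln_mix_density_ge[of k]
      by (intro integral_mono) auto
    finally show "ln (pmf q k) + (t k)\<^sup>2 / 2 \<le>
        (\<integral>x. ln (mix_density ((x + axis i (t k)) $ i)) \<partial>(std_gaussian :: (real ^ 'n) measure))" .
  qed simp
  also have "\<dots> = (\<integral>x. ln (mix_density (x $ i)) \<partial>mixture)"
    using integrable_ln_mix_density by (subst integral_mixture) auto
  finally show ?thesis
    by (simp add: shift_variance_def distrib_left sum.distrib sum_divide_distrib)
qed

text \<open>Convexity of \<open>u ln u\<close>, obtained from \<open>g (ln g - ln f) \<ge> g - f\<close>.\<close>

lemma mix_density_mult_ln_le: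
  "mix_density y * ln (mix_density y) \<le>
    (\<Sum>k\<in>UNIV. pmf q k * (shift_density (t k) y * (t k * y - (t k)\<^sup>2 / 2)))"
proof -
  let ?f = "mix_density y" and ?g = "\<lambda>k. shift_density (t k) y"
  have "?g k - ?f \<le> ?g k * (t k * y - (t k)\<^sup>2 / 2) - ?g k * ln ?f" for k
  proof -
    have "ln (?f / ?g k) \<le> ?f / ?g k - 1"
      by (intro ln_le_minus_one divide_pos_pos mix_density_pos shift_density_pos)
    then have "?g k * ln (?f / ?g k) \<le> ?f - ?g k"
      using shift_density_pos[of "t k" y]
      by (simp add: field_simps)
    moreover have "ln (?f / ?g k) = ln ?f - (t k * y - (t k)\<^sup>2 / 2)"
      using mix_density_pos[of y] by (simp add: ln_div shift_density_def)
    ultimately show ?thesis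
      by (simp add: algebra_simps)
  qed
  then have "(\<Sum>k\<in>UNIV. pmf q k * (?g k - ?f)) \<le>
      (\<Sum>k\<in>UNIV. pmf q k * (?g k * (t k * y - (t k)\<^sup>2 / 2) - ?g k * ln ?f))"
    by (intro sum_mono mult_left_mono) auto
  also have "\<dots> = (\<Sum>k\<in>UNIV. pmf q k * (?g k * (t k * y - (t k)\<^sup>2 / 2))) - ?f * ln ?f"
    by (simp add: right_diff_distrib sum_subtractf mix_density_def sum_distrib_right mult.assoc)
  \<comment> \<open>The linear terms cancel because the mixture density is the weighted average of
    the component densities.\<close>
  also have "(\<Sum>k\<in>UNIV. pmf q k * (?g k - ?f)) = 0"
    by (simp add: right_diff_distrib sum_subtractf mix_density_def flip: sum_distrib_right)
  finally show ?thesis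
    by simp
qed

text \<open>Integrating the convexity bound leaves, for each component,
  \<open>(t k)\<^sup>2 / 2\<close>, the relative entropy of that shifted Gaussian.\<close>

lemma entropy_mixture_le: "(\<integral>x. ln (mix_density (x $ i)) \<partial>mixture) \<le> shift_variance / 2"
proof -
  let ?g = "\<lambda>k (x :: real ^ 'n). shift_density (t k) (x $ i) * (t k * x $ i - (t k)\<^sup>2 / 2)"
  have g: "has_bochner_integral std_gaussian (?g k) ((t k)\<^sup>2 / 2)" for k
    by (simp add: has_bochner_integral_iff integral_shift_density
        std_gaussian.prob_space[simplified] distrib_left power2_eq_square)
  have "integrable std_gaussian (\<lambda>x. mix_density (x $ i) * ln (mix_density (x $ i)))"
    using integrable_mixture_ln_mix_density unfolding mixture_def
    by (subst (asm) integrable_density) (auto simp: mix_density_pos less_imp_le)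
  moreover have "(\<integral>x. ln (mix_density (x $ i)) \<partial>mixture) =
      (\<integral>x. mix_density (x $ i) * ln (mix_density (x $ i)) \<partial>std_gaussian)"
    unfolding mixture_def by (subst integral_density) (auto simp: mix_density_pos less_imp_le)
  moreover have "has_bochner_integral std_gaussian (\<lambda>x. \<Sum>k\<in>UNIV. pmf q k * ?g k x)
      (\<Sum>k\<in>UNIV. pmf q k * ((t k)\<^sup>2 / 2))"
    by (intro has_bochner_integral_sum has_bochner_integral_mult_right g)
  ultimately show ?thesis
    by (auto simp: shift_variance_def sum_divide_distrib has_bochner_integral_iff
        intro!: order_trans[OF integral_mono[OF _ _ mix_density_mult_ln_le]])
qed

section \<open>Upper bound on the transport cost by an explicit coupling\<close>

definition coupling :: "((real ^ 'n) \<times> (real ^ 'n)) measure" where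
  "coupling = distr (measure_pmf q \<Otimes>\<^sub>M std_gaussian) (borel \<Otimes>\<^sub>M borel)
    (\<lambda>(k, x). (x + axis i (t k), x))"

lemma nn_integral_coupling:
  assumes [measurable]: "h \<in> borel_measurable (borel \<Otimes>\<^sub>M borel)"
  shows "(\<integral>\<^sup>+z. h z \<partial>coupling) =
    (\<Sum>k\<in>UNIV. ennreal (pmf q k) * (\<integral>\<^sup>+x. h (x + axis i (t k), x) \<partial>std_gaussian))"
proof -
  \<comment> \<open>The index type is finite, so joint measurability reduces to measurability in
    \<open>x\<close> for each fixed \<open>k\<close>.\<close>
  have [measurable]: "(\<lambda>(k, x). (x + axis i (t k), x)) \<in>
      measure_pmf q \<Otimes>\<^sub>M (std_gaussian :: (real ^ 'n) measure) \<rightarrow>\<^sub>M borel \<Otimes>\<^sub>M borel"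
    by (subst measurable_cong_sets[OF sets_pair_measure_cong[OF sets_measure_pmf_count_space
      sets_std_gaussian] refl], rule measurable_pair_measure_countable1) auto
  have "(\<integral>\<^sup>+z. h z \<partial>coupling) = (\<integral>\<^sup>+z. h (case z of (k, x) \<Rightarrow> (x + axis i (t k), x))
      \<partial>(measure_pmf q \<Otimes>\<^sub>M std_gaussian))"
    unfolding coupling_def by (rule nn_integral_distr) measurable
  also have "\<dots> = (\<integral>\<^sup>+k. \<integral>\<^sup>+x. h (x + axis i (t k), x) \<partial>std_gaussian \<partial>measure_pmf q)"
    by (subst std_gaussian.nn_integral_fst[symmetric]) auto
  also have "\<dots> = (\<Sum>k\<in>UNIV. ennreal (pmf q k) * (\<integral>\<^sup>+x. h (x + axis i (t k), x) \<partial>std_gaussian))"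
    by (subst nn_integral_measure_pmf_support[of UNIV]) (auto simp: mult.commute)
  finally show ?thesis .
qed

lemma coupling_in_couplings: "coupling \<in> couplings mixture std_gaussian"
proof -
  have sets: "sets coupling = sets (borel \<Otimes>\<^sub>M borel)"
    by (simp add: coupling_def)
  have [measurable]: "fst \<in> coupling \<rightarrow>\<^sub>M borel" "fst \<in> coupling \<rightarrow>\<^sub>M mixture"
    "snd \<in> coupling \<rightarrow>\<^sub>M borel" "snd \<in> coupling \<rightarrow>\<^sub>M std_gaussian"
    by (simp_all add: measurable_cong_sets[OF sets refl])
  have "distr coupling mixture fst = mixture"
  proof (rule measure_eqI)
    fix A assume "A \<in> sets (distr coupling mixture fst)"
    then have A [measurable]: "A \<in> sets borel"
      by simp
    have "emeasure (distr coupling mixture fst) A = (\<integral>\<^sup>+z. indicator A (fst z) \<partial>coupling)"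
      by (simp flip: nn_integral_indicator add: nn_integral_distr)
    also have "\<dots> = (\<Sum>k\<in>UNIV. ennreal (pmf q k) *
        (\<integral>\<^sup>+x. indicator A (x + axis i (t k)) \<partial>std_gaussian))"
      by (subst nn_integral_coupling) auto
    also have "\<dots> = (\<Sum>k\<in>UNIV. ennreal (pmf q k) *
        emeasure (distr std_gaussian borel (\<lambda>x. x + axis i (t k))) A)"
      by (simp flip: nn_integral_indicator add: nn_integral_distr)
    \<comment> \<open>Passing from laws of translates to densities lets the weighted sum be
      collected into \<open>mix_density\<close>.\<close>
    also have "\<dots> = (\<Sum>k\<in>UNIV. ennreal (pmf q k) *
        (\<integral>\<^sup>+x. ennreal (shift_density (t k) (x $ i)) * indicator A x \<partial>std_gaussian))"
      unfolding distr_std_gaussian_shift by (simp add: emeasure_density)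
    also have "\<dots> = (\<integral>\<^sup>+x. (\<Sum>k\<in>UNIV. ennreal (pmf q k) *
        (ennreal (shift_density (t k) (x $ i)) * indicator A x)) \<partial>std_gaussian)"
      by (simp add: nn_integral_sum nn_integral_cmult)
    also have "\<dots> = (\<integral>\<^sup>+x. ennreal (mix_density (x $ i)) * indicator A x \<partial>std_gaussian)"
      by (simp add: mix_density_def sum_distrib_right mult.assoc shift_density_pos less_imp_le
          ennreal_mult' flip: sum_ennreal)
    also have "\<dots> = emeasure mixture A"
      by (simp add: mixture_def emeasure_density)
    finally show "emeasure (distr coupling mixture fst) A = emeasure mixture A" .
  qed simp
  moreover have "distr coupling std_gaussian snd = std_gaussian"
  proof (rule measure_eqI)
    fix A assume "A \<in> sets (distr coupling (std_gaussian :: (real ^ 'n) measure) snd)"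
    then have A [measurable]: "A \<in> sets borel"
      by simp
    have "emeasure (distr coupling std_gaussian snd) A = (\<integral>\<^sup>+z. indicator A (snd z) \<partial>coupling)"
      by (simp flip: nn_integral_indicator add: nn_integral_distr)
    also have "\<dots> = (\<Sum>k\<in>UNIV. ennreal (pmf q k)) * emeasure std_gaussian A"
      by (subst nn_integral_coupling) (auto simp flip: sum_distrib_right)
    finally show "emeasure (distr coupling std_gaussian snd) A = emeasure std_gaussian A"
      by simp
  qed simp
  ultimately show ?thesis
    by (simp add: couplings_def sets cong: sets_pair_measure_cong)
qed

text \<open>Under \<open>coupling\<close> the displacement has length \<open>\<bar>t k\<bar>\<close>
  whatever the starting point, so its cost is exactly the mean squared shift.\<close>

lemma transport_cost_mixture_le: "transport_cost mixture std_gaussian \<le> ennreal shift_variance"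
proof -
  have "transport_cost mixture std_gaussian \<le> (\<integral>\<^sup>+(x, y). ennreal ((norm (x - y))\<^sup>2) \<partial>coupling)"
    unfolding transport_cost_def by (rule INF_lower) (rule coupling_in_couplings)
  also have "\<dots> = (\<Sum>k\<in>UNIV. ennreal (pmf q k) * ennreal ((t k)\<^sup>2))"
    by (subst nn_integral_coupling)
      (auto simp: std_gaussian.emeasure_space_1[simplified] power2_norm_eq_inner inner_axis_axis
        simp flip: power2_eq_square)
  also have "\<dots> = ennreal shift_variance"
    by (simp add: shift_variance_def ennreal_mult' flip: sum_ennreal)
  finally show ?thesis .
qed

end

section \<open>Lower bound on the transport cost by duality\<close>

text \<open>Admissibility of the dual pair, by completing two squares. The first bounds (1 -
  \<delta>) x^2 by the cost plus y^2 / \<delta>. The second trades that quadratic term for the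
  constant \<open>K\<close> and a quartic term, whose Gaussian integral is small once K \<delta>^2
  is large.\<close>

lemma dual_potential_le:
  fixes x y \<delta> K :: real
  assumes "0 < \<delta>" "0 < K"
  shows "max 0 ((1 - \<delta>) * x\<^sup>2 - K) \<le> (x - y)\<^sup>2 + y ^ 4 / (4 * K * \<delta>\<^sup>2)"
proof -
  have "(x - y)\<^sup>2 + y\<^sup>2 / \<delta> - (1 - \<delta>) * x\<^sup>2 = (\<delta> * x - y)\<^sup>2 / \<delta> + y\<^sup>2"
    using assms by (simp add: field_simps power2_eq_square)
  then have 1: "(1 - \<delta>) * x\<^sup>2 \<le> (x - y)\<^sup>2 + y\<^sup>2 / \<delta>"
    using assms by (smt (verit) divide_nonneg_pos zero_le_power2)
  have "K + y ^ 4 / (4 * K * \<delta>\<^sup>2) - y\<^sup>2 / \<delta> = (y\<^sup>2 / \<delta> - 2 * K)\<^sup>2 / (4 * K)"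
    using assms by (simp add: field_simps power2_eq_square power4_eq_xxxx)
  then have 2: "y\<^sup>2 / \<delta> \<le> K + y ^ 4 / (4 * K * \<delta>\<^sup>2)"
    using assms by (smt (verit) divide_nonneg_pos zero_le_power2)
  have "0 \<le> (x - y)\<^sup>2 + y ^ 4 / (4 * K * \<delta>\<^sup>2)"
    using assms by simp
  then show ?thesis
    using 1 2 by simp
qed

context gaussian_mixture
begin

text \<open>Weak duality: the pointwise inequality is integrated against an arbitrary coupling,
  whose marginals determine both potential terms. The 3 is the fourth moment of a standard normal
  variable.\<close>

lemma transport_cost_mixture_ge:
  assumes \<delta>: "0 < \<delta>" "\<delta> < 1" and K: "0 < K"
  shows "ennreal ((1 - \<delta>) * shift_variance - K * (\<Sum>k | t k \<noteq> 0. pmf q k) - 3 / (4 * K * \<delta>\<^sup>2)) \<le>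
    transport_cost mixture std_gaussian"
  unfolding transport_cost_def
proof (rule INF_greatest)
  fix \<pi> assume "\<pi> \<in> couplings mixture (std_gaussian :: (real ^ 'n) measure)"
  then have sets: "sets \<pi> = sets (borel \<Otimes>\<^sub>M borel)"
    and fst: "distr \<pi> mixture fst = mixture"
    and snd: "distr \<pi> std_gaussian snd = std_gaussian"
    by (simp_all add: couplings_def cong: sets_pair_measure_cong)
  have [measurable_cong]: "sets \<pi> = sets (borel \<Otimes>\<^sub>M borel)"
    by (rule sets)
  define \<phi> :: "real ^ 'n \<Rightarrow> real" where "\<phi> x = max 0 ((1 - \<delta>) * (x $ i)\<^sup>2 - K)" for x
  define \<psi> :: "real ^ 'n \<Rightarrow> real" where "\<psi> y = (y $ i) ^ 4 / (4 * K * \<delta>\<^sup>2)" for y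
  have [measurable]: "\<phi> \<in> borel_measurable borel" "\<psi> \<in> borel_measurable borel"
    unfolding \<phi>_def \<psi>_def by measurable
  have nonneg: "\<phi> x \<ge> 0" "\<psi> x \<ge> 0" for x
    using K by (auto simp: \<phi>_def \<psi>_def)
  have int_sq: "integrable std_gaussian (\<lambda>x :: real ^ 'n. (x $ i + c)\<^sup>2)" for c
    unfolding power2_sum by simp
  then have int_\<phi>: "integrable std_gaussian (\<lambda>x. \<phi> (x + axis i c))" for c
    by (auto simp: \<phi>_def intro!: Bochner_Integration.integrable_max
        Bochner_Integration.integrable_diff integrable_mult_right)
  \<comment> \<open>The truncation at 0 means that \<open>K\<close> is charged only to components
    with a nonzero shift, whose total weight will be small.\<close>
  have \<phi>_ge: "(1 - \<delta>) * c\<^sup>2 - K * (if c \<noteq> 0 then 1 else 0) \<le>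
      (\<integral>x. \<phi> (x + axis i c) \<partial>std_gaussian)" for c
  proof (cases "c = 0")
    case True
    then show ?thesis
      by (auto intro!: integral_nonneg_AE simp: nonneg)
  next
    case False
    \<comment> \<open>The potential dominates its untruncated form, which integrates to this value;
      the surplus 1 - \<delta> from the Gaussian variance is then discarded.\<close>
    have "(1 - \<delta>) * (1 + c\<^sup>2) - K =
        (\<integral>x. (1 - \<delta>) * (x $ i + c)\<^sup>2 - K \<partial>(std_gaussian :: (real ^ 'n) measure))"
      using int_sq by (simp add: power2_sum std_gaussian.prob_space[simplified])
    also have "\<dots> \<le> (\<integral>x. \<phi> (x + axis i c) \<partial>std_gaussian)"
      using int_sq int_\<phi> by (intro integral_mono) (auto simp: \<phi>_def)
    finally show ?thesis
      using False \<delta> by (simp add: distrib_left)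
  qed
  have "(\<Sum>k | t k \<noteq> 0. pmf q k) = (\<Sum>k\<in>UNIV. pmf q k * (if t k \<noteq> 0 then 1 else 0))"
    using sum.inter_filter[of UNIV "pmf q" "\<lambda>k. t k \<noteq> 0"] by (simp add: if_distrib cong: if_cong)
  then have "(1 - \<delta>) * shift_variance - K * (\<Sum>k | t k \<noteq> 0. pmf q k) =
      (\<Sum>k\<in>UNIV. pmf q k * ((1 - \<delta>) * (t k)\<^sup>2 - K * (if t k \<noteq> 0 then 1 else 0)))"
    unfolding shift_variance_def
    by (simp only: right_diff_distrib sum_subtractf sum_distrib_left mult.left_commute)
  also have "\<dots> \<le> (\<Sum>k\<in>UNIV. pmf q k * (\<integral>x. \<phi> (x + axis i (t k)) \<partial>std_gaussian))"
    by (intro sum_mono mult_left_mono \<phi>_ge) simp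
  also have "\<dots> = (\<integral>x. \<phi> x \<partial>mixture)"
    using int_\<phi> by (intro integral_mixture[symmetric]) auto
  finally have "ennreal ((1 - \<delta>) * shift_variance - K * (\<Sum>k | t k \<noteq> 0. pmf q k)) \<le>
      ennreal (\<integral>x. \<phi> x \<partial>mixture)"
    by (rule ennreal_leI)
  also have "\<dots> = (\<integral>\<^sup>+x. ennreal (\<phi> x) \<partial>mixture)"
    using int_\<phi> nonneg
    by (intro nn_integral_eq_integral[symmetric] integrable_mixture) auto
  also have "\<dots> = (\<integral>\<^sup>+z. ennreal (\<phi> (fst z)) \<partial>\<pi>)"
    by (subst fst[symmetric], subst nn_integral_distr) auto
  also have "\<dots> \<le> (\<integral>\<^sup>+z. (case z of (x, y) \<Rightarrow> ennreal ((norm (x - y))\<^sup>2)) + ennreal (\<psi> (snd z)) \<partial>\<pi>)"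
  proof (rule nn_integral_mono, clarify)
    fix x y :: "real ^ 'n"
    have "(x $ i - y $ i)\<^sup>2 \<le> (norm (x - y))\<^sup>2"
      using component_le_norm_cart[of "x - y" i] by (simp add: abs_le_square_iff[symmetric])
    then have "\<phi> x \<le> (norm (x - y))\<^sup>2 + \<psi> y"
      using dual_potential_le[OF \<delta>(1) K, of "x $ i" "y $ i"] by (simp add: \<phi>_def \<psi>_def)
    then show "ennreal (\<phi> (fst (x, y))) \<le>
        ennreal ((norm (x - y))\<^sup>2) + ennreal (\<psi> (snd (x, y)))"
      using nonneg by (simp add: ennreal_leI flip: ennreal_plus)
  qed
  also have "\<dots> = (\<integral>\<^sup>+(x, y). ennreal ((norm (x - y))\<^sup>2) \<partial>\<pi>) + (\<integral>\<^sup>+z. ennreal (\<psi> (snd z)) \<partial>\<pi>)"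
    by (rule nn_integral_add) measurable
  also have "(\<integral>\<^sup>+z. ennreal (\<psi> (snd z)) \<partial>\<pi>) =
      (\<integral>\<^sup>+y. ennreal (\<psi> y) \<partial>distr \<pi> std_gaussian snd)"
    by (subst nn_integral_distr) auto
  also have "\<dots> = ennreal (\<integral>y. \<psi> y \<partial>std_gaussian)"
    unfolding snd using nonneg by (intro nn_integral_eq_integral) (auto simp: \<psi>_def)
  also have "(\<integral>y. \<psi> y \<partial>std_gaussian) = 3 / (4 * K * \<delta>\<^sup>2)"
    by (simp add: \<psi>_def)
  finally show "ennreal ((1 - \<delta>) * shift_variance - K * (\<Sum>k | t k \<noteq> 0. pmf q k) -
      3 / (4 * K * \<delta>\<^sup>2)) \<le> (\<integral>\<^sup>+(x, y). ennreal ((norm (x - y))\<^sup>2) \<partial>\<pi>)"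
    using K by (subst ennreal_minus[symmetric]) (auto simp: ennreal_minus_le_iff add.commute)
qed

text \<open>The upper bound excludes infinite cost, so the square undoes the root in
  \<open>wasserstein2\<close> and the optimal cost can be handled as a real number.\<close>

lemma wasserstein2_mixture:
  obtains w where "(wasserstein2 mixture std_gaussian)\<^sup>2 = ennreal w"
    "transport_cost mixture std_gaussian = ennreal w" "0 \<le> w" "w \<le> shift_variance"
proof
  let ?w = "enn2real (transport_cost mixture std_gaussian)"
  have fin: "transport_cost mixture std_gaussian < \<infinity>"
    using transport_cost_mixture_le by (rule le_less_trans) simp
  then show w: "transport_cost mixture std_gaussian = ennreal ?w"
    by (simp add: less_top)
  show "(wasserstein2 mixture std_gaussian)\<^sup>2 = ennreal ?w"
    using fin by (simp add: wasserstein2_def ennreal_power)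
  have "shift_variance \<ge> 0"
    by (auto simp: shift_variance_def intro!: sum_nonneg)
  then show "?w \<le> shift_variance"
    using transport_cost_mixture_le by (simp add: enn2real_leI)
qed simp

end

section \<open>Three-point mixtures and the limit\<close>

text \<open>\<open>None\<close> stands for the unshifted component, the two values of
  \<open>Some\<close> for the opposite shifts.\<close>

definition three_point_pmf :: "real \<Rightarrow> bool option pmf" where
  "three_point_pmf \<epsilon> = embed_pmf (\<lambda>k. case k of None \<Rightarrow> 1 - \<epsilon> | Some _ \<Rightarrow> \<epsilon> / 2)"

lemma sum_bool_option: "(\<Sum>k\<in>UNIV. f k) = f None + f (Some True) + f (Some False)"
  for f :: "bool option \<Rightarrow> 'a::comm_monoid_add"
  by (simp add: UNIV_option_conv UNIV_bool add_ac)

lemma pmf_three_point: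
  assumes "0 < \<epsilon>" "\<epsilon> < 1"
  shows "pmf (three_point_pmf \<epsilon>) k = (case k of None \<Rightarrow> 1 - \<epsilon> | Some _ \<Rightarrow> \<epsilon> / 2)"
  unfolding three_point_pmf_def
  using assms
  by (intro pmf_embed_pmf)
    (auto simp: nn_integral_count_space_finite sum_bool_option simp flip: ennreal_plus
      split: option.split)

text \<open>A single parameter \<delta> controls weight, potential and truncation level. The
  explicit bounds reduce the theorem to limits of real functions of \<delta>.\<close>

lemma exists_three_point_mixture:
  fixes s \<delta> :: real
  assumes s: "s > 0" and \<delta>: "0 < \<delta>" "\<delta> < 1"
  shows "\<exists>\<mu> :: (real ^ 'n::finite) measure. prob_space \<mu> \<and> sets \<mu> = sets borel \<and>
    finite_second_moment \<mu> \<and> centered \<mu> \<and> trace (Cov \<mu>) = real CARD('n) + s \<and>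
    (\<exists>D w. talagrand_deficit \<mu> = ereal D \<and> (wasserstein2 \<mu> std_gaussian)\<^sup>2 = ennreal w \<and>
      0 \<le> w \<and> s - \<delta> * (s + 7 / 4) \<le> w \<and>
      2 * ((1 - \<delta> ^ 4) * ln (1 - \<delta> ^ 4) + \<delta> ^ 4 * ln (\<delta> ^ 4 / 2)) \<le> D \<and>
      D \<le> \<delta> * (s + 7 / 4))"
proof -
  \<comment> \<open>With \<open>K = 1 / \<delta>\<^sup>3\<close>, both error terms \<open>K \<epsilon>\<close> and \<open>3 / (4 K \<delta>\<^sup>2)\<close> are of order \<open>\<delta>\<close>.\<close>
  define \<epsilon> where "\<epsilon> = \<delta> ^ 4"
  have \<epsilon>: "0 < \<epsilon>" "\<epsilon> < 1"
    using \<delta> by (simp_all add: \<epsilon>_def power_Suc_less_one power_less_one_iff)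
  define a where "a = sqrt (s / \<epsilon>)"
  have a: "a\<^sup>2 = s / \<epsilon>" "a \<noteq> 0"
    using s \<epsilon> by (simp_all add: a_def)
  define t where "t k = (case k of None \<Rightarrow> 0 | Some b \<Rightarrow> if b then a else - a)" for k
  interpret gaussian_mixture "three_point_pmf \<epsilon>" t "undefined :: 'n"
    by standard (use \<epsilon> in \<open>auto simp: pmf_three_point sum_bool_option t_def split: option.split\<close>)
  have var: "shift_variance = s"
    using \<epsilon> by (simp add: shift_variance_def sum_bool_option pmf_three_point t_def a)
  have H: "(\<Sum>k\<in>UNIV. pmf (three_point_pmf \<epsilon>) k * ln (pmf (three_point_pmf \<epsilon>) k)) =
      (1 - \<epsilon>) * ln (1 - \<epsilon>) + \<epsilon> * ln (\<epsilon> / 2)"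
    using \<epsilon> by (simp add: sum_bool_option pmf_three_point)
  have "{k. t k \<noteq> 0} = {Some True, Some False}"
    using a by (auto simp: t_def split: option.splits if_splits)
  then have P: "(\<Sum>k | t k \<noteq> 0. pmf (three_point_pmf \<epsilon>) k) = \<epsilon>"
    using \<epsilon> by (simp add: pmf_three_point)
  obtain w where w: "(wasserstein2 mixture std_gaussian)\<^sup>2 = ennreal w"
    "transport_cost mixture std_gaussian = ennreal w" "0 \<le> w" "w \<le> s"
    using wasserstein2_mixture unfolding var by blast
  have "(1 - \<delta>) * s - 1 / \<delta> ^ 3 * \<epsilon> - 3 / (4 * (1 / \<delta> ^ 3) * \<delta>\<^sup>2) \<le> w"
    using transport_cost_mixture_ge[OF \<delta>, of "1 / \<delta> ^ 3"] \<delta> w(3)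
    unfolding var P w(2) by (simp add: ennreal_le_iff)
  \<comment> \<open>The three losses are \<delta> s, K \<epsilon> = \<delta> and 3 / (4 K
    \<delta>^2) = 3 \<delta> / 4.\<close>
  then have w_ge: "s - \<delta> * (s + 7 / 4) \<le> w"
    using \<delta> by (simp add: \<epsilon>_def field_simps eval_nat_numeral)
  let ?D = "\<integral>x. ln (mix_density (x $ undefined)) \<partial>mixture"
  \<comment> \<open>Twice the entropy lies between \<open>s\<close> minus twice the Shannon entropy
    of the weights and \<open>s\<close>. Subtracting \<open>w\<close> gives the lower bound from w
    \<le> s and the upper bound from \<open>w_ge\<close>.\<close>
  have "talagrand_deficit mixture = ereal (2 * ?D - w)"
    using w(3) by (simp add: talagrand_deficit_def rel_entropy_mixture w(1))
  then show ?thesis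
    using entropy_mixture_le entropy_mixture_ge prob_space_mixture finite_second_moment_mixture
      centered_mixture trace_Cov_mixture w w_ge
    unfolding var H \<epsilon>_def[symmetric]
    by (intro exI[of _ mixture] conjI exI[of _ "2 * ?D - w"] exI[of _ w]) auto
qed

theorem theorem4:
  fixes \<xi> :: real
  assumes "\<xi> > real CARD('n::finite)"
  shows "\<exists>\<mu> :: nat \<Rightarrow> (real ^ 'n) measure.
    (\<forall>k. prob_space (\<mu> k) \<and> sets (\<mu> k) = sets borel \<and>
         finite_second_moment (\<mu> k) \<and> centered (\<mu> k)) \<and>
    (\<lambda>k. trace (Cov (\<mu> k))) \<longlonglongrightarrow> \<xi> \<and>
    (\<lambda>k. talagrand_deficit (\<mu> k)) \<longlonglongrightarrow> 0 \<and>
    liminf (\<lambda>k. enn2ereal ((wasserstein2 (\<mu> k) std_gaussian)\<^sup>2)) \<ge> ereal (\<xi> - real CARD('n)) \<and>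
    \<xi> - real CARD('n) > 0"
proof -
  define s where "s = \<xi> - real CARD('n)"
  have s: "s > 0"
    using assms by (simp add: s_def)
  \<comment> \<open>The summand 2 keeps \<delta> strictly below 1 already at index 0.\<close>
  define \<delta> :: "nat \<Rightarrow> real" where "\<delta> k = 1 / (real k + 2)" for k
  have \<delta>: "0 < \<delta> k" "\<delta> k < 1" for k
    by (auto simp: \<delta>_def)
  let ?H = "\<lambda>k. 2 * ((1 - \<delta> k ^ 4) * ln (1 - \<delta> k ^ 4) + \<delta> k ^ 4 * ln (\<delta> k ^ 4 / 2))"
  obtain \<mu> :: "nat \<Rightarrow> (real ^ 'n) measure" and D w where
    \<mu>: "\<And>k. prob_space (\<mu> k)" "\<And>k. sets (\<mu> k) = sets borel" "\<And>k. finite_second_moment (\<mu> k)"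
      "\<And>k. centered (\<mu> k)" and trace: "\<And>k. trace (Cov (\<mu> k)) = real CARD('n) + s"
    and D: "\<And>k. talagrand_deficit (\<mu> k) = ereal (D k)"
    and w: "\<And>k. (wasserstein2 (\<mu> k) std_gaussian)\<^sup>2 = ennreal (w k)" "\<And>k. 0 \<le> w k"
    and w_ge: "\<And>k. s - \<delta> k * (s + 7 / 4) \<le> w k"
    and D_ge: "\<And>k. ?H k \<le> D k"
    and D_le: "\<And>k. D k \<le> \<delta> k * (s + 7 / 4)"
    using exists_three_point_mixture[OF s \<delta>, where 'n = 'n] by metis
  \<comment> \<open>The Shannon entropy of the weights vanishes because u ln u tends to 0 both as u
    tends to 0 and as u tends to 1.\<close>
  have "?H \<longlonglongrightarrow> 0"
    unfolding \<delta>_def by real_asymp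
  moreover have \<delta>_lim: "(\<lambda>k. \<delta> k * (s + 7 / 4)) \<longlonglongrightarrow> 0"
    unfolding \<delta>_def by real_asymp
  ultimately have "D \<longlonglongrightarrow> 0"
    by (rule tendsto_sandwich[rotated 2]) (use D_ge D_le in auto)
  then have deficit: "(\<lambda>k. talagrand_deficit (\<mu> k)) \<longlonglongrightarrow> 0"
    by (simp add: D zero_ereal_def)
  have "(\<lambda>k. ereal (s - \<delta> k * (s + 7 / 4))) \<longlonglongrightarrow> ereal s"
    using tendsto_diff[OF tendsto_const \<delta>_lim, of s] by simp
  then have "ereal s = liminf (\<lambda>k. ereal (s - \<delta> k * (s + 7 / 4)))"
    by (intro lim_imp_Liminf[symmetric]) auto
  also have "\<dots> \<le> liminf (\<lambda>k. enn2ereal ((wasserstein2 (\<mu> k) std_gaussian)\<^sup>2))"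
    using w w_ge by (intro Liminf_mono) (auto simp: enn2ereal_ennreal)
  finally show ?thesis
    using s \<mu> deficit trace by (intro exI[of _ \<mu>]) (auto simp: s_def)
qed

end
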